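(* Let $c\in\mathbb{C}^n$. The quasi-Newton method with the modified Jacobian matrix $$\widetilde J_{4,k}=\begin{bmatrix} M(\mu_k) & M'(\mu_k)x_{k+1}\\ c^H & 0\end{bmatrix}$$ is equivalent to the method of successive linear problems. That is, a sequence $(\mu_k,x_k)_{k\ge 0}$ in $\Omega\times\mathbb{C}^n$ satisfies $$\widetilde J_{4,k}\begin{bmatrix} x_{k+1}-x_k\\ \mu_{k+1}-\mu_k\end{bmatrix}=-\begin{bmatrix} M(\mu_k)x_k\\ c^Hx_k-1\end{bmatrix}\qquad\text{for all }k\ge 0$$ if and only if, for all $k\ge 0$, with $\Delta\mu_k=\mu_{k+1}-\mu_k$, the pair $(\Delta\mu_k,x_{k+1})$ is an eigenpair of the linear generalized eigenvalue problem $$M(\mu_k)x_{k+1}+\Delta\mu_k\,M'(\mu_k)x_{k+1}=0,\qquad x_{k+1}\neq 0,$$ with the eigenvector normalized by $c^Hx_{k+1}=1$.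
   Context: $\Omega\subset\mathbb{C}$ is a closed set, and $M:\Omega\to\mathbb{C}^{n\times n}$ is analytic (holomorphic) in $\Omega$. The nonlinear eigenvalue problem is to find $\lambda\in\Omega$ and $v\neq0$ with $M(\lambda)v=0$. The superscript $H$ denotes conjugate transpose. The method of successive linear problems (Ruhe) repeatedly solves, for the current eigenvalue approximation $\mu_k$, the linear generalized eigenvalue problem $(M(\mu_k)+\Delta\mu_k M'(\mu_k))x_{k+1}=0$ for an eigenvalue $\Delta\mu_k$ and eigenvector $x_{k+1}$ (normalized by $c^Hx_{k+1}=1$), and updates $\mu_{k+1}=\mu_k+\Delta\mu_k$. *)

theory Defs
  imports "HOL-Analysis.Analysis"
begin

definition matrix_analytic_on :: "(complex \<Rightarrow> complex^'n^'m) \<Rightarrow> complex set \<Rightarrow> bool" where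
  "matrix_analytic_on M S \<longleftrightarrow> (\<forall>i j. (\<lambda>z. M z $ i $ j) analytic_on S)"

definition matrix_deriv :: "(complex \<Rightarrow> complex^'n^'m) \<Rightarrow> complex \<Rightarrow> complex^'n^'m" where
  "matrix_deriv M z = (\<chi> i j. deriv (\<lambda>w. M w $ i $ j) z)"

definition conj_transpose :: "complex^'n^'m \<Rightarrow> complex^'m^'n" where
  "conj_transpose A = (\<chi> i j. cnj (A $ j $ i))"

(* The row vector c^H as a 1-by-n matrix; consequently c^H x is an element of complex^1,
   and the scalar a is represented there by vec a. *)
abbreviation herm_row :: "complex^'n \<Rightarrow> complex^'n^1" where
  "herm_row c \<equiv> conj_transpose (columnvector c)"

definition block_matrix ::
  "'a^'n^'m \<Rightarrow> 'a^'p^'m \<Rightarrow> 'a^'n^'q \<Rightarrow> 'a^'p^'q \<Rightarrow> 'a^('n + 'p)^('m + 'q)" where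
  "block_matrix A B C D = (\<chi> i j.
     case i of
       Inl i' \<Rightarrow> (case j of Inl j' \<Rightarrow> A $ i' $ j' | Inr j' \<Rightarrow> B $ i' $ j')
     | Inr i' \<Rightarrow> (case j of Inl j' \<Rightarrow> C $ i' $ j' | Inr j' \<Rightarrow> D $ i' $ j'))"

definition block_vector :: "'a^'n \<Rightarrow> 'a^'p \<Rightarrow> 'a^('n + 'p)" where
  "block_vector u v = (\<chi> i. case i of Inl i' \<Rightarrow> u $ i' | Inr i' \<Rightarrow> v $ i')"

(* The modified Jacobian at the current eigenvalue approximation m; y is the
   new eigenvector iterate, so the method it defines is implicit in y. *)
definition modified_jacobian ::
  "(complex \<Rightarrow> complex^'n^'n) \<Rightarrow> complex^'n \<Rightarrow> complex \<Rightarrow> complex^'n \<Rightarrow> complex^('n + 1)^('n + 1)" where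
  "modified_jacobian M c m y =
     block_matrix (M m) (columnvector (matrix_deriv M m *v y)) (herm_row c) 0"

(* The nonlinear eigenvalue problem with normalization c^H x = 1, as a system F (x, m) = 0. *)
definition nep_residual ::
  "(complex \<Rightarrow> complex^'n^'n) \<Rightarrow> complex^'n \<Rightarrow> complex \<Rightarrow> complex^'n \<Rightarrow> complex^('n + 1)" where
  "nep_residual M c m x = block_vector (M m *v x) (herm_row c *v x - vec 1)"

(* Eigenpair of the linear pencil A + d B (plus sign, not A - d B). *)
definition pencil_eigenpair ::
  "complex^'n^'n \<Rightarrow> complex^'n^'n \<Rightarrow> complex \<Rightarrow> complex^'n \<Rightarrow> bool" where
  "pencil_eigenpair A B d v \<longleftrightarrow> A *v v + d *s (B *v v) = 0 \<and> v \<noteq> 0"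

end

theory Submission
  imports Defs
begin

text \<open>
  Newton's equation for an affine map is independent of the point at which it is
  linearised. The residual is affine in the vector argument, so in the increments
  \<open>x (Suc k) - x k\<close> the old iterate \<open>x k\<close> cancels against the residual: the first block row
  becomes the linear pencil equation for \<open>x (Suc k)\<close> with eigenvalue \<open>\<mu> (Suc k) - \<mu> k\<close>, because
  the Jacobian carries \<open>M' x\<close> at the new vector, and the second becomes the normalization
  of \<open>x (Suc k)\<close>. The normalization in turn forces \<open>x (Suc k) \<noteq> 0\<close>, which the Newton equation
  does not assert explicitly. The equivalence is therefore a blockwise identity that holds for each
  step separately (\<open>modified_newton_step_iff\<close>).
\<close>

lemma block_matrix_vector_mult:
  fixes A :: "'a::semiring_1^'n^'m"
  shows "block_matrix A B C D *v block_vector u v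
    = block_vector (A *v u + B *v v) (C *v u + D *v v)"
  by (simp add: vec_eq_iff block_matrix_def block_vector_def matrix_vector_mult_def
      UNIV_Plus_UNIV[symmetric] sum.Plus split: sum.splits del: UNIV_Plus_UNIV)

lemma block_vector_eq_iff:
  "block_vector u v = block_vector u' v' \<longleftrightarrow> u = u' \<and> v = v'"
  by (auto simp: block_vector_def vec_eq_iff split: sum.splits)

lemma uminus_block_vector:
  fixes u :: "'a::group_add^'n"
  shows "- block_vector u v = block_vector (- u) (- v)"
  by (simp add: block_vector_def vec_eq_iff split: sum.splits)

lemma columnvector_vector_mult_vec:
  fixes b :: "'a::comm_semiring_1^'n"
  shows "(columnvector b :: 'a^1^'n) *v vec d = d *s b"
  by (simp add: vec_eq_iff columnvector_def matrix_vector_mult_def mult.commute)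

text \<open>
  Both sides of the Newton equation contain \<open>- (M m *v x)\<close> in the first block and
  \<open>- (herm_row c *v x)\<close> in the second. Cancelling them removes \<open>x\<close> altogether, so the new pair
  depends on the old one through \<open>m\<close> alone.
\<close>

lemma modified_newton_step_iff:
  "modified_jacobian M c m y *v block_vector (y - x) (vec d) = - nep_residual M c m x
    \<longleftrightarrow> pencil_eigenpair (M m) (matrix_deriv M m) d y \<and> herm_row c *v y = vec 1"
proof -
  have "modified_jacobian M c m y *v block_vector (y - x) (vec d) = - nep_residual M c m x
    \<longleftrightarrow> M m *v y + d *s (matrix_deriv M m *v y) = 0 \<and> herm_row c *v y = vec 1"
    by (simp add: modified_jacobian_def nep_residual_def block_matrix_vector_mult
        uminus_block_vector block_vector_eq_iff columnvector_vector_mult_vec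
        matrix_vector_mult_diff_distrib)
  moreover have "y \<noteq> 0" if "herm_row c *v y = vec 1"
  proof
    assume "y = 0"
    with that have "vec 1 = (0 :: complex^1)"
      by simp
    then show False
      by (simp add: vec_eq_iff)
  qed
  ultimately show ?thesis
    by (auto simp: pencil_eigenpair_def)
qed

theorem theorem2p5:
  fixes \<Omega> :: "complex set"
    and M :: "complex \<Rightarrow> complex^'n^'n"
    and c :: "complex^'n"
    and \<mu> :: "nat \<Rightarrow> complex"
    and x :: "nat \<Rightarrow> complex^'n"
  assumes "closed \<Omega>"
    and "matrix_analytic_on M \<Omega>"
    and "\<And>k. \<mu> k \<in> \<Omega>"
  shows "(\<forall>k. modified_jacobian M c (\<mu> k) (x (Suc k))
              *v block_vector (x (Suc k) - x k) (vec (\<mu> (Suc k) - \<mu> k))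
            = - nep_residual M c (\<mu> k) (x k))
    \<longleftrightarrow>
         (\<forall>k. pencil_eigenpair (M (\<mu> k)) (matrix_deriv M (\<mu> k)) (\<mu> (Suc k) - \<mu> k) (x (Suc k))
            \<and> herm_row c *v x (Suc k) = vec 1)"
  by (simp only: modified_newton_step_iff)

end
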